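(* For every non-principal ultrafilter $\mathscr{U}$ on $\omega$, $\mathfrak{g}\leq\mathrm{cin}(\omega^\omega/\mathscr{U})$.
   Context: For an ultrafilter $\mathscr{U}$ on $\omega$ and $f,g\in\omega^\omega$, $f\leq_{\mathscr{U}} g$ means $\{n\in\omega : f(n)\leq g(n)\}\in\mathscr{U}$. The cardinal $\mathrm{cin}(\omega^\omega/\mathscr{U})$ is the least cardinality of a family $D$ of finite-to-one non-decreasing functions in $\omega^\omega$ such that for every finite-to-one non-decreasing $f\in\omega^\omega$ there is $g\in D$ with $g\leq_{\mathscr{U}} f$. A set $G\subseteq[\omega]^\omega$ (infinite subsets of $\omega$) is groupwise dense if $G$ is closed under infinite subsets and finite modifications, and for every partition $\langle I_n : n\in\omega\rangle$ of $\omega$ into finite intervals there is an infinite $A\subseteq\omega$ such that $\bigcup_{n\in A} I_n\in G$. $\mathfrak{g}$ is the least cardinality of a collection of groupwise dense sets with empty intersection. *)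

theory Defs
  imports "HOL-Library.Disjoint_Sets"
begin

unbundle cardinal_syntax

(* Cardinals are rendered as cardinal orders and compared with <=o, as in HOL.  The set D is
   determined only up to equinumerosity, so the resulting cardinal is unique up to =o. *)
definition least_card :: "'a set set \<Rightarrow> 'a rel" where
  "least_card F = |SOME D. D \<in> F \<and> (\<forall>E\<in>F. |D| \<le>o |E| )|"

lemma least_card:
  assumes "F \<noteq> {}"
  shows least_card_attained: "\<exists>D\<in>F. least_card F = |D|"
    and least_card_le: "E \<in> F \<Longrightarrow> least_card F \<le>o |E|"
proof -
  have "\<exists>r\<in>card_of ` F. \<forall>r'\<in>card_of ` F. r \<le>o r'"
    using assms by (intro exists_minim_Card_order) (auto simp: card_of_Card_order)
  then have "\<exists>D. D \<in> F \<and> (\<forall>E\<in>F. |D| \<le>o |E| )"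
    by auto
  then have *: "(SOME D. D \<in> F \<and> (\<forall>E\<in>F. |D| \<le>o |E| )) \<in> F \<and>
      (\<forall>E\<in>F. |SOME D. D \<in> F \<and> (\<forall>E\<in>F. |D| \<le>o |E| )| \<le>o |E| )"
    by (rule someI_ex)
  show "\<exists>D\<in>F. least_card F = |D|"
    using * unfolding least_card_def by blast
  show "E \<in> F \<Longrightarrow> least_card F \<le>o |E|"
    using * unfolding least_card_def by blast
qed

(* A filter U stands for the family of sets {A. eventually (\<lambda>n. n \<in> A) U};
   since HOL filters may be improper, bot has to be excluded. *)
definition ultrafilter :: "'a filter \<Rightarrow> bool" where
  "ultrafilter U \<longleftrightarrow> U \<noteq> bot \<and> (\<forall>P. eventually P U \<or> eventually (\<lambda>x. \<not> P x) U)"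

definition nonprincipal_ultrafilter :: "'a filter \<Rightarrow> bool" where
  "nonprincipal_ultrafilter U \<longleftrightarrow> ultrafilter U \<and> (\<forall>x. U \<noteq> principal {x})"

definition le_mod :: "nat filter \<Rightarrow> (nat \<Rightarrow> nat) \<Rightarrow> (nat \<Rightarrow> nat) \<Rightarrow> bool" where
  "le_mod U f g \<longleftrightarrow> eventually (\<lambda>n. f n \<le> g n) U"

definition finite_to_one :: "('a \<Rightarrow> 'b) \<Rightarrow> bool" where
  "finite_to_one f \<longleftrightarrow> (\<forall>y. finite (f -` {y}))"

definition finite_to_one_monos :: "(nat \<Rightarrow> nat) set" where
  "finite_to_one_monos = {f. finite_to_one f \<and> mono f}"

definition coinitial_families :: "nat filter \<Rightarrow> (nat \<Rightarrow> nat) set set" where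
  "coinitial_families U = {D. D \<subseteq> finite_to_one_monos \<and> (\<forall>f\<in>finite_to_one_monos. \<exists>g\<in>D. le_mod U g f)}"

definition cin :: "nat filter \<Rightarrow> (nat \<Rightarrow> nat) rel" where
  "cin U = least_card (coinitial_families U)"

lemma coinitial_families_nonempty: "coinitial_families U \<noteq> {}"
proof -
  have "finite_to_one_monos \<in> coinitial_families U"
    by (auto simp: coinitial_families_def le_mod_def intro!: bexI)
  then show ?thesis by blast
qed

(* The intervals of the partition are nonempty, but need not be enumerated in increasing order. *)
definition interval_partition :: "(nat \<Rightarrow> nat set) \<Rightarrow> bool" where
  "interval_partition I \<longleftrightarrow>
    (\<forall>n. \<exists>a b. a \<le> b \<and> I n = {a..b}) \<and> disjoint_family I \<and> (\<Union>n. I n) = UNIV"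

definition groupwise_dense :: "nat set set \<Rightarrow> bool" where
  "groupwise_dense G \<longleftrightarrow>
    G \<subseteq> {X. infinite X} \<and>
    (\<forall>X\<in>G. \<forall>Y. Y \<subseteq> X \<and> infinite Y \<longrightarrow> Y \<in> G) \<and>
    (\<forall>X\<in>G. \<forall>Y. finite (sym_diff X Y) \<longrightarrow> Y \<in> G) \<and>
    (\<forall>I. interval_partition I \<longrightarrow> (\<exists>A. infinite A \<and> (\<Union>n\<in>A. I n) \<in> G))"

(* The empty collection does not qualify, as its intersection is UNIV. *)
definition gd_families :: "nat set set set set" where
  "gd_families = {C. (\<forall>G\<in>C. groupwise_dense G) \<and> \<Inter>C = {}}"

definition groupwise_density_number :: "nat set set rel" where
  "groupwise_density_number = least_card gd_families"

lemma gd_families_nonempty: "gd_families \<noteq> {}"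
proof -
  define G where "G X = {Y::nat set. infinite Y \<and> infinite (X - Y)}" for X
  have gd: "groupwise_dense (G X)" if X: "infinite X" for X
    unfolding groupwise_dense_def
  proof (intro conjI ballI allI impI)
    show "G X \<subseteq> {X. infinite X}" by (auto simp: G_def)
  next
    fix Z Y assume *: "Z \<in> G X" "Y \<subseteq> Z \<and> infinite Y"
    then have "X - Z \<subseteq> X - Y" by blast
    with * show "Y \<in> G X" by (auto simp: G_def dest: finite_subset)
  next
    fix Z Y assume *: "Z \<in> G X" "finite (sym_diff Z Y)"
    have "Z \<subseteq> Y \<union> sym_diff Z Y" "X - Z \<subseteq> (X - Y) \<union> sym_diff Z Y" by auto
    with * show "Y \<in> G X" by (auto simp: G_def dest: finite_subset)
  next
    fix I :: "nat \<Rightarrow> nat set" assume "interval_partition I"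
    then have I: "\<exists>a b. a \<le> b \<and> I n = {a..b}" and disj: "disjoint_family I"
      and cover: "(\<Union>n. I n) = UNIV" for n
      by (auto simp: interval_partition_def)
    have fin: "finite (I n)" and ne: "I n \<noteq> {}" for n using I[of n] by auto
    have eq: "m = n" if "x \<in> I m" "x \<in> I n" for x m n
      using disj that by (auto simp: disjoint_family_on_def)
    define B where "B = {n. I n \<inter> X \<noteq> {}}"
    have "X \<subseteq> (\<Union>n\<in>B. I n)" using cover unfolding B_def by blast
    then have "infinite B" using X fin by (meson finite_UN finite_subset)
    then obtain r :: "nat \<Rightarrow> nat" where r: "inj r" "range r \<subseteq> B"
      using infinite_countable_subset by blast
    define A where "A = range (\<lambda>n. r (2 * n))"
    have "infinite A"
      unfolding A_def by (subst finite_image_iff) (auto intro!: injI simp: inj_eq[OF r(1)])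
    define s where "s n = (SOME x. x \<in> I n)" for n
    have s: "s n \<in> I n" for n using ne[of n] unfolding s_def by (simp add: some_in_eq)
    have "inj_on s A" by (rule inj_onI) (metis s eq)
    then have "infinite (s ` A)" using \<open>infinite A\<close> by (simp add: finite_image_iff)
    then have inf1: "infinite (\<Union>n\<in>A. I n)"
      by (rule contrapos_nn) (erule rev_finite_subset, use s in blast)
    have "\<forall>n. \<exists>x. x \<in> I (r (2 * n + 1)) \<inter> X" using r(2) by (auto simp: B_def)
    then obtain t where t: "\<And>n. t n \<in> I (r (2 * n + 1))" "\<And>n. t n \<in> X" unfolding choice_iff by blast
    have "inj t"
    proof (rule injI)
      fix m n assume "t m = t n"
      then have "r (2 * m + 1) = r (2 * n + 1)" using t(1)[of m] t(1)[of n] by (intro eq[of "t m"]) simp_all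
      then show "m = n" by (simp add: inj_eq[OF r(1)])
    qed
    have "t n \<notin> I (r (2 * m))" for m n
    proof
      assume "t n \<in> I (r (2 * m))"
      then have "r (2 * m) = r (2 * n + 1)" by (rule eq[OF _ t(1)])
      then have "2 * m = 2 * n + 1" by (simp only: inj_eq[OF r(1)])
      then show False by presburger
    qed
    then have "range t \<subseteq> X - (\<Union>n\<in>A. I n)" using t(2) by (auto simp: A_def)
    then have "infinite (X - (\<Union>n\<in>A. I n))"
      by (rule infinite_super) (simp add: finite_image_iff \<open>inj t\<close>)
    with inf1 \<open>infinite A\<close> show "\<exists>A. infinite A \<and> (\<Union>n\<in>A. I n) \<in> G X"
      by (auto simp: G_def)
  qed
  have "\<Inter> (G ` {X. infinite X}) = {}"
  proof (rule equals0I)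
    fix Y assume Y: "Y \<in> \<Inter> (G ` {X. infinite X})"
    then have "Y \<in> G UNIV" by blast
    then have "infinite Y" by (simp add: G_def)
    then have "Y \<in> G Y" using Y by blast
    then show False by (simp add: G_def)
  qed
  then have "G ` {X. infinite X} \<in> gd_families" using gd by (auto simp: gd_families_def)
  then show ?thesis by blast
qed

end

theory Submission
  imports Defs "HOL-Library.Infinite_Set"
begin

text \<open>
  An infinite set \<open>X\<close> of naturals has a counting function \<open>n \<mapsto> card (X \<inter> {..<n})\<close>, which is
  non-decreasing and finite-to-one, and which grows slowly when \<open>X\<close> is sparse. For a
  finite-to-one non-decreasing \<open>g\<close>, the class \<open>sparse_sets U g\<close> consists of the infinite sets whose
  counting function, even after adding a constant, stays strictly below \<open>g\<close> modulo \<open>U\<close>. If \<open>D\<close> is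
  coinitial, then no \<open>X\<close> lies in all these classes for \<open>g \<in> D\<close>, because some \<open>g \<in> D\<close> is below the
  counting function of \<open>X\<close>. So \<open>D\<close> yields at most \<open>|D|\<close> classes with empty intersection,
  and everything comes down to their groupwise density.

  The closure properties are immediate, the added constant absorbing finite modifications.
  For the partition property (\<open>groups_in_sparse_sets\<close>), intervals of the partition are picked one
  after the other, waiting after each one until \<open>g\<close> has overtaken everything counted so far. This
  cuts the naturals into consecutive blocks with one chosen interval in each. The union of
  the intervals chosen in the even blocks has a small counting function on the odd blocks, and
  vice versa. The ultrafilter contains either the union of the even blocks or that of the odd
  blocks, so one of the two unions of intervals is as desired.
\<close>

section \<open>Ultrafilters, counting functions and interval partitions\<close>

text \<open>
  An ultrafilter that does not avoid the point \<open>x\<close> contains \<open>{x}\<close> and hence is principal.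
\<close>

lemma nonprincipal_ultrafilter_le_sequentially:
  assumes "nonprincipal_ultrafilter U"
  shows "U \<le> sequentially"
proof -
  have U: "U \<noteq> bot" "\<And>P. eventually P U \<or> eventually (\<lambda>x. \<not> P x) U"
    and np: "\<And>x. U \<noteq> principal {x}"
    using assms by (auto simp: nonprincipal_ultrafilter_def ultrafilter_def)
  have point: "eventually (\<lambda>n. n \<noteq> x) U" for x
  proof (rule ccontr)
    assume "\<not> eventually (\<lambda>n. n \<noteq> x) U"
    then have ev: "eventually (\<lambda>n. n = x) U" using U(2)[of "\<lambda>n. n = x"] by blast
    have "eventually P U \<longleftrightarrow> P x" for P
    proof
      assume "eventually P U"
      with ev have "eventually (\<lambda>n. P x) U" by eventually_elim simp
      then show "P x" using U(1) by (simp add: eventually_const)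
    next
      assume "P x"
      then show "eventually P U" by (intro eventually_mono[OF ev]) simp
    qed
    then have "U = principal {x}" by (simp add: filter_eq_iff eventually_principal)
    then show False using np by blast
  qed
  have tail: "eventually (\<lambda>n. N \<le> n) U" for N
  proof -
    have "eventually (\<lambda>n. \<forall>x\<in>{..<N}. n \<noteq> x) U"
      using point by (intro eventually_ball_finite) auto
    then show ?thesis by (rule eventually_mono) force
  qed
  show ?thesis
  proof (rule filter_leI)
    fix P :: "nat \<Rightarrow> bool" assume "eventually P sequentially"
    then obtain N where "\<forall>n\<ge>N. P n" by (auto simp: eventually_sequentially)
    then show "eventually P U" by (intro eventually_mono[OF tail[of N]]) blast
  qed
qed

lemma counting_function_finite_to_one_mono:
  fixes X :: "nat set"
  assumes "infinite X"
  shows "(\<lambda>n. card (X \<inter> {..<n})) \<in> finite_to_one_monos"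
proof -
  have mono: "mono (\<lambda>n. card (X \<inter> {..<n}))"
    by (intro monoI card_mono) auto
  have "finite ((\<lambda>n. card (X \<inter> {..<n})) -` {y})" for y
  proof -
    obtain B where B: "finite B" "card B = Suc y" "B \<subseteq> X"
      using assms infinite_arbitrarily_large by blast
    obtain N where N: "B \<subseteq> {..<N}"
      using B(1) finite_nat_iff_bounded by blast
    have "n < N" if "card (X \<inter> {..<n}) = y" for n
    proof (rule ccontr)
      assume "\<not> n < N"
      with N B(3) have "B \<subseteq> X \<inter> {..<n}" by auto
      then have "Suc y \<le> card (X \<inter> {..<n})" by (metis B(2) card_mono finite_Int finite_lessThan)
      with that show False by simp
    qed
    then show ?thesis by (auto intro: finite_subset[OF _ finite_lessThan[of N]])
  qed
  with mono show ?thesis by (auto simp: finite_to_one_monos_def finite_to_one_def)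
qed

lemma finite_to_one_mono_unbounded:
  assumes "g \<in> finite_to_one_monos"
  shows "\<exists>m. \<forall>n\<ge>m. c < g n"
proof -
  have fin: "\<And>y. finite (g -` {y})" and mono: "mono g"
    using assms by (auto simp: finite_to_one_monos_def finite_to_one_def)
  have "finite (\<Union>y\<in>{..c}. g -` {y})" using fin by blast
  then obtain m where "m \<notin> (\<Union>y\<in>{..c}. g -` {y})" using ex_new_if_finite infinite_UNIV_nat by blast
  then have "c < g m" by auto
  then show ?thesis using monoD[OF mono] less_le_trans by blast
qed

lemma interval_partition_member_beyond:
  assumes "interval_partition I"
  shows "\<exists>n q. I n \<subseteq> {p..<q} \<and> I n \<noteq> {}"
proof -
  have I: "\<exists>a b. a \<le> b \<and> I n = {a..b}" and disj: "disjoint_family I"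
    and cover: "(\<Union>n. I n) = UNIV" for n
    using assms by (auto simp: interval_partition_def)
  have "\<forall>x. \<exists>n. x \<in> I n" using cover by blast
  then obtain i where i: "\<And>x. x \<in> I (i x)" by metis
  obtain n where n: "n \<notin> i ` {..<p}"
    using ex_new_if_finite[of "i ` {..<p}"] by auto
  have ge: "p \<le> x" if "x \<in> I n" for x
  proof (rule ccontr)
    assume "\<not> p \<le> x"
    with n have "n \<noteq> i x" by auto
    with disj that i[of x] show False by (auto simp: disjoint_family_on_def)
  qed
  obtain a b where "a \<le> b" "I n = {a..b}" using I by blast
  then have "I n \<subseteq> {p..<Suc b}" "I n \<noteq> {}" using ge by auto
  then show ?thesis by blast
qed

section \<open>Sets with a small counting function\<close>

text \<open>
  The quantifier over \<open>k\<close> makes the class invariant under finite modifications, which change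
  the counting function by a bounded amount only.
\<close>

definition sparse_sets :: "nat filter \<Rightarrow> (nat \<Rightarrow> nat) \<Rightarrow> nat set set" where
  "sparse_sets U g =
    {X. infinite X \<and> (\<forall>k. eventually (\<lambda>n. card (X \<inter> {..<n}) + k < g n) U)}"

lemma sparse_sets_almost_subset:
  assumes X: "X \<in> sparse_sets U g" and Y: "infinite Y" and fin: "finite (Y - X)"
  shows "Y \<in> sparse_sets U g"
  unfolding sparse_sets_def
proof (intro CollectI conjI allI)
  fix k
  have bound: "card (Y \<inter> {..<n}) \<le> card (X \<inter> {..<n}) + card (Y - X)" for n
  proof -
    have "card (Y \<inter> {..<n}) \<le> card ((X \<inter> {..<n}) \<union> (Y - X))"
      using fin by (intro card_mono) auto
    also have "\<dots> \<le> card (X \<inter> {..<n}) + card (Y - X)" by (rule card_Un_le)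
    finally show ?thesis .
  qed
  have "eventually (\<lambda>n. card (X \<inter> {..<n}) + (card (Y - X) + k) < g n) U"
    using X by (auto simp: sparse_sets_def)
  then show "eventually (\<lambda>n. card (Y \<inter> {..<n}) + k < g n) U"
  proof (rule eventually_mono)
    fix n assume "card (X \<inter> {..<n}) + (card (Y - X) + k) < g n"
    with bound[of n] show "card (Y \<inter> {..<n}) + k < g n" by linarith
  qed
qed (rule Y)

section \<open>Groupwise density\<close>

text \<open>
  When \<open>n\<close> lies in a block \<open>k + 1\<close> that contributes nothing to the union, the part of the union
  below \<open>n\<close> lies below \<open>q k\<close>, so at most \<open>q k\<close> elements are counted, and \<open>g\<close> has already passed
  \<open>q k + k\<close> at the start of that block. Hence missing the contributing blocks modulo the filter
  forces the union to be sparse.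
\<close>

lemma union_over_missed_blocks_sparse:
  fixes p q :: "nat \<Rightarrow> nat" and J :: "nat \<Rightarrow> nat set"
  assumes U: "U \<le> sequentially" and g: "mono g"
    and p0: "p 0 = 0" and p: "strict_mono p"
    and J: "\<And>k. J k \<subseteq> {p k..<q k}" "\<And>k. J k \<noteq> {}"
    and q: "\<And>k. q k \<le> p (Suc k)" "\<And>k. q k + k < g (p (Suc k))"
    and K: "infinite K"
    and missed: "eventually (\<lambda>n. \<forall>k\<in>K. n \<notin> {p k..<p (Suc k)}) U"
  shows "(\<Union>k\<in>K. J k) \<in> sparse_sets U g"
  unfolding sparse_sets_def
proof (intro CollectI conjI allI)
  show "infinite (\<Union>k\<in>K. J k)"
    unfolding infinite_nat_iff_unbounded_le
  proof
    fix m
    obtain k where k: "k \<in> K" "m \<le> k" using K infinite_nat_iff_unbounded_le by blast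
    obtain x where x: "x \<in> J k" using J(2) by blast
    have "k \<le> p k" by (rule strict_mono_imp_increasing[OF p])
    with x k J(1)[of k] show "\<exists>x\<ge>m. x \<in> (\<Union>k\<in>K. J k)" by (intro exI[of _ x]) auto
  qed
next
  fix j
  have "eventually (\<lambda>n. p (Suc j) \<le> n) U"
    using U by (rule filter_leD) (rule eventually_ge_at_top)
  with missed show "eventually (\<lambda>n. card ((\<Union>k\<in>K. J k) \<inter> {..<n}) + j < g n) U"
  proof eventually_elim
    case (elim n)
    have "n < p (Suc n)"
      using strict_mono_imp_increasing[OF p, of "Suc n"] by simp
    then obtain k where k: "n < p (Suc k)" "\<And>i. i < k \<Longrightarrow> \<not> n < p (Suc i)"
      using exists_least_iff[of "\<lambda>k. n < p (Suc k)"] by blast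
    have "j < k"
      using le_less_trans[OF elim(2) k(1)] by (simp add: strict_mono_less[OF p])
    then obtain i where i: "k = Suc i" using less_imp_Suc_add by blast
    have n: "p k \<le> n" using k(2)[of i] i by simp
    then have kK: "k \<notin> K" using elim(1) k(1) by auto
    have "(\<Union>k\<in>K. J k) \<inter> {..<n} \<subseteq> {..<q i}"
    proof
      fix x assume "x \<in> (\<Union>k\<in>K. J k) \<inter> {..<n}"
      then obtain l where l: "l \<in> K" "x \<in> J l" "x < n" by blast
      have xl: "p l \<le> x" "x < q l" using l(2) J(1)[of l] by auto
      then have "p l < p (Suc k)" using l(3) k(1) by linarith
      then have "l \<le> k" using p by (simp add: strict_mono_less)
      then have "l \<le> i" using kK l(1) i by (metis le_Suc_eq)
      have "q l \<le> q i"
      proof (cases "l = i")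
        case False
        then have "p (Suc l) \<le> p i" using \<open>l \<le> i\<close> p by (simp add: strict_mono_less_eq)
        moreover have "p i \<le> q i" using J(1)[of i] J(2)[of i] by fastforce
        ultimately show ?thesis using q(1)[of l] by linarith
      qed simp
      with xl show "x \<in> {..<q i}" by simp
    qed
    then have "card ((\<Union>k\<in>K. J k) \<inter> {..<n}) \<le> q i"
      using card_mono[of "{..<q i}"] by fastforce
    moreover have "q i + i < g n"
      using q(2)[of i] monoD[OF g n] i by simp
    ultimately show ?case using \<open>j < k\<close> i by linarith
  qed
qed

lemma groups_in_sparse_sets:
  assumes U: "nonprincipal_ultrafilter U" and g: "g \<in> finite_to_one_monos"
    and I: "interval_partition I"
  shows "\<exists>A. infinite A \<and> (\<Union>n\<in>A. I n) \<in> sparse_sets U g"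
proof -
  have Useq: "U \<le> sequentially" by (rule nonprincipal_ultrafilter_le_sequentially[OF U])
  have mono: "mono g" using g by (simp add: finite_to_one_monos_def)
  have fin: "finite (I n)" for n
  proof -
    obtain a b where "I n = {a..b}" using I unfolding interval_partition_def by blast
    then show ?thesis by simp
  qed
  \<comment> \<open>A block starting at \<open>p\<close> contains the interval \<open>I n\<close> and lasts until \<open>g\<close> exceeds \<open>q + k\<close>.\<close>
  have "\<exists>n q p'. I n \<subseteq> {p..<q} \<and> I n \<noteq> {} \<and> q \<le> p' \<and> q + k < g p'" for p k
  proof -
    obtain n q where nq: "I n \<subseteq> {p..<q}" "I n \<noteq> {}"
      using interval_partition_member_beyond[OF I] by blast
    obtain m where "\<forall>n\<ge>m. q + k < g n" using finite_to_one_mono_unbounded[OF g] by blast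
    then have "q \<le> max m q" "q + k < g (max m q)" by auto
    with nq show ?thesis by blast
  qed
  then obtain N Q P where
    step: "\<And>p k. I (N p k) \<subseteq> {p..<Q p k} \<and> I (N p k) \<noteq> {} \<and> Q p k \<le> P p k \<and> Q p k + k < g (P p k)"
    by metis
  define p where "p = rec_nat 0 (\<lambda>k x. P x k)"
  have p0: "p 0 = 0" and pS: "p (Suc k) = P (p k) k" for k by (simp_all add: p_def)
  define a where "a k = N (p k) k" for k
  define q where "q k = Q (p k) k" for k
  have J: "I (a k) \<subseteq> {p k..<q k}" "I (a k) \<noteq> {}" and q: "q k \<le> p (Suc k)" "q k + k < g (p (Suc k))"
    for k using step[of "p k" k] by (auto simp: a_def q_def pS)
  have "p k < p (Suc k)" for k using J[of k] q(1)[of k] by fastforce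
  then have p: "strict_mono p" by (simp add: strict_mono_Suc_iff)
  have reduce: ?thesis if K: "infinite K"
    and missed: "eventually (\<lambda>n. \<forall>k\<in>K. n \<notin> {p k..<p (Suc k)}) U" for K
  proof -
    have "(\<Union>k\<in>K. I (a k)) \<in> sparse_sets U g"
      by (rule union_over_missed_blocks_sparse[OF Useq mono p0 p J q K missed])
    then have mem: "(\<Union>n\<in>a ` K. I n) \<in> sparse_sets U g" by simp
    then have "infinite (\<Union>n\<in>a ` K. I n)" by (simp add: sparse_sets_def)
    then have "infinite (a ` K)" using fin by (meson finite_UN_I)
    with mem show ?thesis by blast
  qed
  have inf: "infinite {k::nat. even k}" "infinite {k::nat. odd k}"
    unfolding infinite_nat_iff_unbounded_le mem_Collect_eq by presburger+
  define E where "E n \<longleftrightarrow> (\<exists>k. even k \<and> n \<in> {p k..<p (Suc k)})" for n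
  have odd_blocks: "n \<notin> {p k..<p (Suc k)}" if "E n" "odd k" for n k
  proof
    assume k: "n \<in> {p k..<p (Suc k)}"
    obtain l where l: "even l" "n \<in> {p l..<p (Suc l)}" using \<open>E n\<close> by (auto simp: E_def)
    then have "p k < p (Suc l)" "p l < p (Suc k)" using k by auto
    then have "k = l" using p by (simp add: strict_mono_less)
    with l that show False by simp
  qed
  have "eventually E U \<or> eventually (\<lambda>n. \<not> E n) U"
    using U by (simp add: nonprincipal_ultrafilter_def ultrafilter_def)
  then show ?thesis
  proof
    assume "eventually E U"
    then have "eventually (\<lambda>n. \<forall>k\<in>{k. odd k}. n \<notin> {p k..<p (Suc k)}) U"
      by (rule eventually_mono) (use odd_blocks in blast)
    then show ?thesis by (rule reduce[OF inf(2)])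
  next
    assume "eventually (\<lambda>n. \<not> E n) U"
    then have "eventually (\<lambda>n. \<forall>k\<in>{k. even k}. n \<notin> {p k..<p (Suc k)}) U"
      by (rule eventually_mono) (unfold E_def, blast)
    then show ?thesis by (rule reduce[OF inf(1)])
  qed
qed

lemma groupwise_dense_sparse_sets:
  assumes "nonprincipal_ultrafilter U" "g \<in> finite_to_one_monos"
  shows "groupwise_dense (sparse_sets U g)"
  unfolding groupwise_dense_def
proof (intro conjI ballI allI impI)
  show "sparse_sets U g \<subseteq> {X. infinite X}" by (auto simp: sparse_sets_def)
next
  fix X Y assume "X \<in> sparse_sets U g" "Y \<subseteq> X \<and> infinite Y"
  then show "Y \<in> sparse_sets U g"
    by (metis sparse_sets_almost_subset Diff_eq_empty_iff finite.emptyI)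
next
  fix X Y assume X: "X \<in> sparse_sets U g" and fin: "finite (sym_diff X Y)"
  have "X \<subseteq> Y \<union> sym_diff X Y" by blast
  then have "infinite Y" using X fin by (auto simp: sparse_sets_def dest: finite_subset)
  with X fin show "Y \<in> sparse_sets U g" by (auto intro: sparse_sets_almost_subset)
next
  fix I assume "interval_partition I"
  with assms show "\<exists>A. infinite A \<and> (\<Union>n\<in>A. I n) \<in> sparse_sets U g"
    by (rule groups_in_sparse_sets)
qed

section \<open>Coinitial families\<close>

lemma Inter_sparse_sets_coinitial:
  assumes U: "U \<noteq> bot" and D: "D \<in> coinitial_families U"
  shows "\<Inter> (sparse_sets U ` D) = {}"
proof (rule equals0I)
  fix X assume X: "X \<in> \<Inter> (sparse_sets U ` D)"
  have coinit: "\<exists>g\<in>D. le_mod U g f" if "f \<in> finite_to_one_monos" for f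
    using D that by (simp add: coinitial_families_def)
  \<comment> \<open>An intersection over the empty family would be \<open>UNIV\<close>, which contains finite sets.\<close>
  have "D \<noteq> {}" using coinit counting_function_finite_to_one_mono[OF infinite_UNIV_nat] by blast
  then have "infinite X" using X by (auto simp: sparse_sets_def)
  then obtain g where g: "g \<in> D" "le_mod U g (\<lambda>n. card (X \<inter> {..<n}))"
    using coinit counting_function_finite_to_one_mono by blast
  have "\<forall>k. eventually (\<lambda>n. card (X \<inter> {..<n}) + k < g n) U"
    using X g(1) by (auto simp: sparse_sets_def)
  then have "eventually (\<lambda>n. card (X \<inter> {..<n}) + 0 < g n) U" by blast
  with g(2) have "eventually (\<lambda>n. False) U"
    unfolding le_mod_def by eventually_elim simp
  with U show False by (simp add: eventually_False)
qed

theorem theorem2p2: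
  fixes U :: "nat filter"
  assumes "nonprincipal_ultrafilter U"
  shows "groupwise_density_number \<le>o cin U"
proof -
  obtain D where D: "D \<in> coinitial_families U" and cin: "cin U = |D|"
    using least_card_attained[OF coinitial_families_nonempty] unfolding cin_def by blast
  have "D \<subseteq> finite_to_one_monos" using D by (simp add: coinitial_families_def)
  moreover have "U \<noteq> bot"
    using assms by (simp add: nonprincipal_ultrafilter_def ultrafilter_def)
  ultimately have "sparse_sets U ` D \<in> gd_families"
    unfolding gd_families_def
    using groupwise_dense_sparse_sets[OF assms] Inter_sparse_sets_coinitial[OF _ D] by blast
  then have "groupwise_density_number \<le>o |sparse_sets U ` D|"
    unfolding groupwise_density_number_def by (rule least_card_le[OF gd_families_nonempty])
  also have "|sparse_sets U ` D| \<le>o |D|" by (rule card_of_image)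
  finally show ?thesis unfolding cin .
qed

end
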